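(* Let $K$ be an algebraically closed field of characteristic $0$, $G$ a finite abelian group, and let $\Gamma\colon A=\bigoplus_{g\in G}A_g$ be a $G$-graded regular $K$-algebra. Then $(A,\Gamma)$ does not satisfy the primeness property for graded central polynomials.
   Context: Algebras are associative. Abelian groups are written additively. A $G$-grading on $A$ is a decomposition $A=\bigoplus_{g\in G}A_g$ into subspaces with $A_gA_h\subseteq A_{g+h}$. It is regular if (i) for every $n\in\mathbb N$ and $(g_1,\dots,g_n)\in G^n$ there exist $a_i\in A_{g_i}$ with $a_1\cdots a_n\neq 0$; and (ii) for every $g,h\in G$ there is a scalar $\beta(g,h)\in K^*$, depending only on $g,h$, such that $a_ga_h=\beta(g,h)a_ha_g$ for all $a_g\in A_g$, $a_h\in A_h$. $K\langle X_G\rangle$ is the free unitary associative $G$-graded algebra on countably infinite disjoint sets $X_g$ ($g\in G$) of variables of degree $g$, written $x_i^{(g)}$. Let $(A,\Gamma)$ be $G$-graded. A polynomial $f(x_1^{(g_1)},\dots,x_n^{(g_n)})\in K\langle X_G\rangle$ is a graded identity of $A$ if it vanishes under all substitutions $x_i^{(g_i)}\mapsto a_i\in A_{g_i}$; it is a graded central polynomial if all these values lie in the centre $Z(A)$; it is a proper graded central polynomial if moreover it is not a graded identity. $(A,\Gamma)$ satisfies the primeness property for graded central polynomials if, whenever $f,g\in K\langle X_G\rangle$ are polynomials in disjoint sets of variables such that $fg$ is a proper graded central polynomial, both $f$ and $g$ are proper graded central polynomials.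
   Formalization: The formal statement adds the hypothesis that A is not a commutative algebra with unit; for such A (e.g. A = K with G trivial) every polynomial is central and the primeness property holds, so the claim fails. If A has no unit, polynomials with nonzero constant term count as not central. *)

theory Defs
  imports "HOL-Computational_Algebra.Computational_Algebra" "HOL-Library.Poly_Mapping"
begin

section \<open>Associative algebras\<close>

text \<open>The algebra is a whole type of class \<^class>\<open>ring\<close>, hence associative
  but not necessarily unitary.\<close>

locale assoc_algebra = vector_space scale
  for scale :: "'k::field \<Rightarrow> 'a::ring \<Rightarrow> 'a" +
  assumes scale_mult_left: "scale c x * y = scale c (x * y)"
    and mult_scale_right: "x * scale c y = scale c (x * y)"

definition is_unity :: "'a::ring \<Rightarrow> bool" where
  "is_unity e \<longleftrightarrow> (\<forall>x. e * x = x \<and> x * e = x)"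

text \<open>The degenerate case in which the theorem fails: over a commutative unitary algebra every
  graded polynomial is central, so the primeness property holds trivially, although such an
  algebra can be regular (a field graded by the trivial group, for instance).\<close>

definition commutative_unitary :: "'a::ring itself \<Rightarrow> bool" where
  "commutative_unitary T \<longleftrightarrow> (\<exists>e::'a. is_unity e) \<and> (\<forall>x y::'a. x * y = y * x)"

definition center :: "'a::ring set" where
  "center = {z. \<forall>x. z * x = x * z}"

text \<open>Product of a nonempty list from left to right; \<^const>\<open>prod_list\<close> needs a unit.\<close>

definition list_mult :: "'a::ring list \<Rightarrow> 'a" where
  "list_mult as = foldl (*) (hd as) (tl as)"


section \<open>Regular gradings\<close>

definition grading :: "('k::field \<Rightarrow> 'a::ring \<Rightarrow> 'a) \<Rightarrow> ('g::{finite, ab_group_add} \<Rightarrow> 'a set) \<Rightarrow> bool"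
  where
  "grading scale A \<longleftrightarrow>
     (\<forall>g. module.subspace scale (A g)) \<and>
     (\<forall>x. \<exists>!c. (\<forall>g. c g \<in> A g) \<and> x = (\<Sum>g\<in>UNIV. c g)) \<and>
     (\<forall>g h. \<forall>a\<in>A g. \<forall>b\<in>A h. a * b \<in> A (g + h))"

definition regular_grading ::
    "('k::field \<Rightarrow> 'a::ring \<Rightarrow> 'a) \<Rightarrow> ('g::{finite, ab_group_add} \<Rightarrow> 'a set) \<Rightarrow> bool" where
  "regular_grading scale A \<longleftrightarrow>
     grading scale A \<and>
     (\<forall>gs. gs \<noteq> [] \<longrightarrow> (\<exists>as. list_all2 (\<lambda>a g. a \<in> A g) as gs \<and> list_mult as \<noteq> 0)) \<and>
     (\<forall>g h. \<exists>\<beta>. \<beta> \<noteq> 0 \<and> (\<forall>a\<in>A g. \<forall>b\<in>A h. a * b = scale \<beta> (b * a)))"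


section \<open>The free unitary graded algebra\<close>

text \<open>A wrapper around lists that makes concatenation the addition of a (noncommutative)
  monoid, so that the convolution product of \<^type>\<open>poly_mapping\<close> is the product of
  noncommutative polynomials.\<close>

datatype 'x word = Word (letters: "'x list")

instantiation word :: (type) monoid_add
begin

definition zero_word :: "'a word" where
  "0 = Word []"

definition plus_word :: "'a word \<Rightarrow> 'a word \<Rightarrow> 'a word" where
  "v + w = Word (letters v @ letters w)"

instance
  by standard (simp_all add: zero_word_def plus_word_def)

end

text \<open>The letter \<^term>\<open>(i, g)\<close> is the \<^term>\<open>i\<close>-th variable of degree \<^term>\<open>g\<close>.\<close>

type_synonym ('g, 'k) gpoly = "(nat \<times> 'g) word \<Rightarrow>\<^sub>0 'k"

definition vars :: "('g, 'k::zero) gpoly \<Rightarrow> (nat \<times> 'g) set" where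
  "vars f = (\<Union>w\<in>Poly_Mapping.keys f. set (letters w))"

definition graded_subst :: "('g \<Rightarrow> 'a set) \<Rightarrow> (nat \<times> 'g \<Rightarrow> 'a) \<Rightarrow> bool" where
  "graded_subst A \<phi> \<longleftrightarrow> (\<forall>i g. \<phi> (i, g) \<in> A g)"

text \<open>\<^term>\<open>has_value scale \<phi> f v\<close>: the substitution \<^term>\<open>\<phi>\<close> takes \<^term>\<open>f\<close> to the element
  \<^term>\<open>v\<close> of the algebra. The constant term is substituted as a multiple of the unit of the
  algebra. If the algebra has no unit, a polynomial with nonzero constant term has no value
  in it (its value lies in the algebra with a unit adjoined, outside the algebra itself).\<close>

definition has_value ::
    "('k::field \<Rightarrow> 'a::ring \<Rightarrow> 'a) \<Rightarrow> (nat \<times> 'g \<Rightarrow> 'a) \<Rightarrow> ('g, 'k) gpoly \<Rightarrow> 'a \<Rightarrow> bool" where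
  "has_value scale \<phi> f v \<longleftrightarrow>
     (let c = Poly_Mapping.lookup f 0;
          s = (\<Sum>w\<in>Poly_Mapping.keys f - {0}.
                 scale (Poly_Mapping.lookup f w) (list_mult (map \<phi> (letters w))))
      in if c = 0 then v = s else (\<exists>e. is_unity e \<and> v = scale c e + s))"


section \<open>Graded central polynomials\<close>

definition graded_identity ::
    "('k::field \<Rightarrow> 'a::ring \<Rightarrow> 'a) \<Rightarrow> ('g \<Rightarrow> 'a set) \<Rightarrow> ('g, 'k) gpoly \<Rightarrow> bool" where
  "graded_identity scale A f \<longleftrightarrow> (\<forall>\<phi>. graded_subst A \<phi> \<longrightarrow> has_value scale \<phi> f 0)"

definition graded_central ::
    "('k::field \<Rightarrow> 'a::ring \<Rightarrow> 'a) \<Rightarrow> ('g \<Rightarrow> 'a set) \<Rightarrow> ('g, 'k) gpoly \<Rightarrow> bool" where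
  "graded_central scale A f \<longleftrightarrow>
     (\<forall>\<phi>. graded_subst A \<phi> \<longrightarrow> (\<exists>v\<in>center. has_value scale \<phi> f v))"

definition proper_graded_central ::
    "('k::field \<Rightarrow> 'a::ring \<Rightarrow> 'a) \<Rightarrow> ('g \<Rightarrow> 'a set) \<Rightarrow> ('g, 'k) gpoly \<Rightarrow> bool" where
  "proper_graded_central scale A f \<longleftrightarrow> graded_central scale A f \<and> \<not> graded_identity scale A f"

definition primeness_property ::
    "('k::field \<Rightarrow> 'a::ring \<Rightarrow> 'a) \<Rightarrow> ('g \<Rightarrow> 'a set) \<Rightarrow> bool" where
  "primeness_property scale A \<longleftrightarrow>
     (\<forall>f g :: ('g, 'k) gpoly.
        vars f \<inter> vars g = {} \<longrightarrow> proper_graded_central scale A (f * g) \<longrightarrow>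
        proper_graded_central scale A f \<and> proper_graded_central scale A g)"

end

theory Submission
  imports Defs
begin

text \<open>Regularity forces the neutral component \<^term>\<open>A 0\<close> to be central. In
  the identity \<open>a\<^sub>0 a\<^sub>h = \<beta>(0,h) a\<^sub>h a\<^sub>0\<close> an element of \<^term>\<open>A 0\<close> may be replaced by a product of
  two such elements, so that \<open>\<beta>(0,h)\<^sup>2 = \<beta>(0,h)\<close>, that is \<open>\<beta>(0,h) = 1\<close>, because some
  product of degrees \<open>0,0,h\<close> is nonzero (\<open>neutral_component_central\<close>). Consequently, for every degree \<^term>\<open>g\<close>, the monomial
  \<open>x\<^sub>0\<^sup>(\<^sup>g\<^sup>) x\<^sub>1\<^sup>(\<^sup>-\<^sup>g\<^sup>)\<close> is central, and regularity says that it is not an identity.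

  If the algebra is not commutative, some homogeneous component \<^term>\<open>A g\<close> is not contained in
  the center, since elements are sums of homogeneous ones. The left factor \<open>x\<^sub>0\<^sup>(\<^sup>g\<^sup>)\<close> takes all
  values in \<^term>\<open>A g\<close>, so it is not central, and the primeness property fails for the
  factorization of this monomial into its two letters
  (\<open>not_primeness_property_if_noncommutative\<close>).

  If the algebra is commutative, it has no unit. In an algebra without unit \<open>1 \<cdot> x\<^sub>0\<^sup>(\<^sup>0\<^sup>)\<close> is properly central, whereas
  the factor 1 has no value in the algebra, so it is not a central polynomial of it
  (\<open>not_primeness_property_if_no_unity\<close>).\<close>


section \<open>Values of monomials\<close>

definition letter :: "nat \<Rightarrow> 'g \<Rightarrow> ('g, 'k::zero_neq_one) gpoly" where
  "letter i g = Poly_Mapping.single (Word [(i, g)]) 1"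

lemma vars_letter: "vars (letter i g :: ('g, 'k::zero_neq_one) gpoly) = {(i, g)}"
  by (simp add: vars_def letter_def)

lemma vars_one: "vars (1 :: ('g, 'k::zero_neq_one) gpoly) = {}"
  by (simp add: vars_def zero_word_def)

lemma letter_times_letter:
  "letter i g * letter j h
   = (Poly_Mapping.single (Word [(i, g), (j, h)]) 1 :: ('g, 'k::semiring_1) gpoly)"
  by (simp add: letter_def mult_single plus_word_def)

context assoc_algebra
begin

lemma has_value_monomial:
  assumes "w \<noteq> 0"
  shows "has_value scale \<phi> (Poly_Mapping.single w 1) v \<longleftrightarrow> v = list_mult (map \<phi> (letters w))"
  using assms by (simp add: has_value_def lookup_single)

lemma has_value_letter: "has_value scale \<phi> (letter i g) v \<longleftrightarrow> v = \<phi> (i, g)"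
  by (simp add: letter_def has_value_monomial zero_word_def list_mult_def)

lemma has_value_letter_times_letter:
  "has_value scale \<phi> (letter i g * letter j h) v \<longleftrightarrow> v = \<phi> (i, g) * \<phi> (j, h)"
  by (simp add: letter_times_letter has_value_monomial zero_word_def list_mult_def)

lemma has_value_one: "has_value scale \<phi> 1 v \<longleftrightarrow> is_unity v"
proof -
  have "u = v" if "is_unity u" "is_unity v" for u v :: 'a
    using that unfolding is_unity_def by metis
  then show ?thesis
    by (auto simp: has_value_def lookup_one)
qed

end


section \<open>Commutation in regular algebras\<close>

locale regular_graded_algebra = assoc_algebra scale
  for scale :: "'k::field \<Rightarrow> 'a::ring \<Rightarrow> 'a" +
  fixes A :: "'g::{finite, ab_group_add} \<Rightarrow> 'a set"
  assumes regular: "regular_grading scale A"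
begin

lemma zero_mem: "0 \<in> A g"
proof -
  have "subspace (A g)"
    using regular by (simp add: regular_grading_def grading_def)
  then show ?thesis
    by (rule subspace_0)
qed

lemma mult_mem: "a \<in> A g \<Longrightarrow> b \<in> A h \<Longrightarrow> a * b \<in> A (g + h)"
  using regular by (simp add: regular_grading_def grading_def)

lemma homogeneous_decomposition:
  obtains c where "\<And>g. c g \<in> A g" "x = (\<Sum>g\<in>UNIV. c g)"
proof -
  have "\<exists>!c. (\<forall>g. c g \<in> A g) \<and> x = (\<Sum>g\<in>UNIV. c g)"
    using regular by (simp add: regular_grading_def grading_def)
  from ex1_implies_ex[OF this] show ?thesis
    using that by blast
qed

lemma commutation_scalar:
  obtains \<beta> where "\<And>a b. a \<in> A g \<Longrightarrow> b \<in> A h \<Longrightarrow> a * b = scale \<beta> (b * a)"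
proof -
  have "\<exists>\<beta>. \<forall>a\<in>A g. \<forall>b\<in>A h. a * b = scale \<beta> (b * a)"
    using regular unfolding regular_grading_def by meson
  then show ?thesis
    using that by blast
qed

lemma nonzero_product:
  assumes "gs \<noteq> []"
  obtains as where "list_all2 (\<lambda>a g. a \<in> A g) as gs" "list_mult as \<noteq> 0"
proof -
  have "\<exists>as. list_all2 (\<lambda>a g. a \<in> A g) as gs \<and> list_mult as \<noteq> 0"
    using assms regular by (simp add: regular_grading_def)
  then show ?thesis
    using that by blast
qed

lemma nonzero_product1:
  obtains a where "a \<in> A g" "a \<noteq> 0"
  by (rule nonzero_product[of "[g]"]) (auto simp: list_all2_Cons2 list_mult_def)

lemma nonzero_product2:
  obtains a b where "a \<in> A g" "b \<in> A h" "a * b \<noteq> 0"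
  by (rule nonzero_product[of "[g, h]"]) (auto simp: list_all2_Cons2 list_mult_def)

lemma nonzero_product3:
  obtains a b c where "a \<in> A g" "b \<in> A h" "c \<in> A k" "a * b * c \<noteq> 0"
  by (rule nonzero_product[of "[g, h, k]"]) (auto simp: list_all2_Cons2 list_mult_def)

lemma commute_if_commute_with_homogeneous:
  assumes "\<And>g b. b \<in> A g \<Longrightarrow> a * b = b * a"
  shows "a * x = x * a"
proof -
  obtain c where c: "\<And>g. c g \<in> A g" "x = (\<Sum>g\<in>UNIV. c g)"
    using homogeneous_decomposition[of x] by blast
  have "(\<Sum>g\<in>UNIV. a * c g) = (\<Sum>g\<in>UNIV. c g * a)"
    using c(1) assms by (intro sum.cong refl) blast
  then show ?thesis
    by (simp add: c(2) sum_distrib_left sum_distrib_right)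
qed

text \<open>The scalar for degrees \<open>0\<close> and \<^term>\<open>h\<close> is 1: since \<open>0 + 0 = 0\<close>, moving a product of two
  neutral elements past an element of degree \<^term>\<open>h\<close> costs both the scalar and its square.\<close>

lemma neutral_component_central: "A 0 \<subseteq> center"
proof
  fix a assume a: "a \<in> A 0"
  have "a * b = b * a" if b: "b \<in> A h" for h b
  proof -
    obtain \<beta> where \<beta>: "\<And>a b. a \<in> A 0 \<Longrightarrow> b \<in> A h \<Longrightarrow> a * b = scale \<beta> (b * a)"
      using commutation_scalar[of 0 h] by blast
    obtain p q r where pqr: "p \<in> A 0" "q \<in> A 0" "r \<in> A h" "p * q * r \<noteq> 0"
      by (rule nonzero_product3)
    \<comment> \<open>Move \<open>p * q\<close> past \<open>r\<close> once as a single factor and once letter by letter.\<close>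
    have once: "p * q * r = scale \<beta> (r * p * q)"
      using \<beta>[of "p * q" r] mult_mem[of p 0 q 0] pqr by (simp add: mult.assoc)
    have "p * q * r = p * scale \<beta> (r * q)"
      using \<beta> pqr by (simp add: mult.assoc)
    also have "\<dots> = scale \<beta> (p * r * q)"
      by (simp add: mult_scale_right mult.assoc)
    also have "\<dots> = scale \<beta> (scale \<beta> (r * p * q))"
      using \<beta>[of p r] pqr by (simp add: scale_mult_left)
    finally have "p * q * r = scale \<beta> (p * q * r)"
      by (simp add: once)
    then have "scale (\<beta> - 1) (p * q * r) = 0"
      by (simp add: scale_left_diff_distrib)
    then have "\<beta> = 1"
      using pqr by simp
    then show ?thesis
      using \<beta> a b by simp
  qed
  then show "a \<in> center"
    unfolding center_def by (blast intro: commute_if_commute_with_homogeneous)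
qed

lemma graded_subst_zero: "graded_subst A (\<lambda>_. 0)"
  by (simp add: graded_subst_def zero_mem)

lemma graded_subst_update:
  assumes "graded_subst A \<phi>" "a \<in> A g"
  shows "graded_subst A (\<phi>((i, g) := a))"
  using assms by (simp add: graded_subst_def)

lemma letter_central_imp_component_central:
  assumes "graded_central scale A (letter i g)"
  shows "A g \<subseteq> center"
proof
  fix a assume "a \<in> A g"
  then have "graded_subst A ((\<lambda>_. 0)((i, g) := a))"
    by (intro graded_subst_update graded_subst_zero)
  then show "a \<in> center"
    using assms unfolding graded_central_def by (fastforce simp: has_value_letter)
qed

lemma letter_not_identity: "\<not> graded_identity scale A (letter i g)"
proof -
  obtain a where "a \<in> A g" "a \<noteq> 0"
    by (rule nonzero_product1)
  then show ?thesis
    using graded_subst_update[OF graded_subst_zero, of a g i]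
    by (force simp: graded_identity_def has_value_letter)
qed

lemma letter_times_inverse_letter_proper_central:
  assumes "i \<noteq> j"
  shows "proper_graded_central scale A (letter i g * letter j (- g))"
proof -
  have "graded_central scale A (letter i g * letter j (- g))"
    unfolding graded_central_def graded_subst_def
    using mult_mem[of _ g _ "- g"] neutral_component_central
    by (auto simp: has_value_letter_times_letter)
  moreover
  obtain a b where "a \<in> A g" "b \<in> A (- g)" "a * b \<noteq> 0"
    by (rule nonzero_product2)
  then have "\<not> graded_identity scale A (letter i g * letter j (- g))"
    using graded_subst_update[OF graded_subst_update[OF graded_subst_zero], of a g b "- g" i j] assms
    by (force simp: graded_identity_def has_value_letter_times_letter)
  ultimately show ?thesis
    by (simp add: proper_graded_central_def)
qed


section \<open>Failure of the primeness property\<close>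

lemma not_primeness_property_if_noncommutative:
  assumes "x * y \<noteq> y * (x :: 'a)"
  shows "\<not> primeness_property scale A"
proof
  assume prime: "primeness_property scale A"
  obtain g a where a: "a \<in> A g" "a * x \<noteq> x * a"
    using assms commute_if_commute_with_homogeneous[of x y] by metis
  have "vars (letter 0 g :: ('g, 'k) gpoly) \<inter> vars (letter 1 (- g) :: ('g, 'k) gpoly) = {}"
    by (simp add: vars_letter)
  then have "graded_central scale A (letter 0 g)"
    using prime letter_times_inverse_letter_proper_central[of 0 1 g]
    unfolding primeness_property_def proper_graded_central_def by (metis zero_neq_one)
  then have "a \<in> center"
    using a letter_central_imp_component_central by blast
  then show False
    using a by (simp add: center_def)
qed

lemma not_primeness_property_if_no_unity:
  assumes "\<And>e :: 'a. \<not> is_unity e"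
  shows "\<not> primeness_property scale A"
proof
  assume prime: "primeness_property scale A"
  have "graded_central scale A (letter 0 0)"
    using neutral_component_central
    by (auto simp: graded_central_def graded_subst_def has_value_letter)
  then have "proper_graded_central scale A (1 * letter 0 0)"
    by (simp add: proper_graded_central_def letter_not_identity)
  moreover have "vars (1 :: ('g, 'k) gpoly) \<inter> vars (letter 0 0 :: ('g, 'k) gpoly) = {}"
    by (simp add: vars_one)
  ultimately have "graded_central scale A (1 :: ('g, 'k) gpoly)"
    using prime unfolding primeness_property_def proper_graded_central_def by metis
  then show False
    using assms graded_subst_zero by (auto simp: graded_central_def has_value_one)
qed

end

theorem theorem16:
  fixes scale :: "'k::{alg_closed_field, field_char_0} \<Rightarrow> 'a::ring \<Rightarrow> 'a"
    and A :: "'g::{finite, ab_group_add} \<Rightarrow> 'a set"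
  assumes "assoc_algebra scale"
    and "regular_grading scale A"
    and "\<not> commutative_unitary TYPE('a)"
  shows "\<not> primeness_property scale A"
proof -
  interpret regular_graded_algebra scale A
    using assms by (simp add: regular_graded_algebra_def regular_graded_algebra_axioms_def)
  show ?thesis
    using assms(3) not_primeness_property_if_noncommutative not_primeness_property_if_no_unity
    unfolding commutative_unitary_def by blast
qed

end
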